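(* Let $(\mathcal{C},\lambda)$ be the contact manifold $\mathcal{C}=\mathbb{R}^3$ with coordinates $(x,p,z)$ and $\lambda=dz-p\,dx$, let $\Lambda_0,\theta,\gamma_0$ be positive constants with $\gamma_0>\Lambda_0$, and let $\psi(x)=\ln\cosh(x)+\ln2$. Suppose $x(t)=(x(0)-\theta)e^{-\Lambda_0t}+\theta$. Then the contact Hamiltonian vector field associated to $$h(x,p,z)=-\Lambda_0(x-\theta)\Big(\frac{d\psi}{dx}(x)-p\Big)+\gamma_0(\psi(x)-z),$$ namely $$\frac{dx}{dt}=-\Lambda_0(x-\theta),$$ $$\frac{dp}{dt}=-\Lambda_0(x-\theta)\frac{d^2\psi}{dx^2}(x)-\Lambda_0\Big(\frac{d\psi}{dx}(x)-p\Big)+\gamma_0\Big(\frac{d\psi}{dx}(x)-p\Big),$$ $$\frac{dz}{dt}=-\Lambda_0(x-\theta)\frac{d\psi}{dx}(x)+\gamma_0(\psi(x)-z),$$ or equivalently, with $\Delta_0=\psi(x)-z$ and $\Delta_1=\frac{d\psi}{dx}(x)-p$, $$\frac{dx}{dt}=-\Lambda_0(x-\theta),\qquad \frac{d\Delta_1}{dt}=\Lambda_0\Delta_1-\gamma_0\Delta_1,\qquad \frac{d\Delta_0}{dt}=-\gamma_0\Delta_0,$$ models a relaxation dynamics: along every solution, $$x(\infty)=\theta,\qquad z(\infty)=\psi(x(\infty)),\qquad p(\infty)=\frac{d\psi}{dx}(x(\infty)),$$ where $x(\infty),p(\infty),z(\infty)$ denote the limits as $t\to\infty$.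
   Context: The contact Hamiltonian vector field $X_h$ of a function $h$ on $(\mathbb{R}^3,\lambda=dz-p\,dx)$ is defined by $\iota_{X_h}\lambda=h$, $\iota_{X_h}d\lambda=-(dh-(\partial h/\partial z)\lambda)$; in coordinates $\dot x=-\partial h/\partial p$, $\dot p=\partial h/\partial x+p\,\partial h/\partial z$, $\dot z=h-p\,\partial h/\partial p$. (Interpretation, not needed for the statement: $x$ is a magnetic field divided by $k_BT$ with constant temperature $T$, $p$ the magnetization and $z$ the negative dimensionless Helmholtz free energy of a spin system.) *)

theory Defs
  imports "HOL-Analysis.Analysis"
begin

text \<open>
  Points of the contact manifold are triples (x, p, z). Every tangent space is identified with
  the model space \<^typ>\<open>real \<times> real \<times> real\<close> through the global chart, so a vector field is a map
  from the space to itself and a 1-form maps a point and a tangent vector to a real.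
\<close>

type_synonym pt = "real \<times> real \<times> real"

text \<open>The contact form \<open>dz - p dx\<close>.\<close>
definition contact_form :: "pt \<Rightarrow> pt \<Rightarrow> real" where
  "contact_form = (\<lambda>(x, p, z) (vx, vp, vz). vz - p * vx)"

definition differential :: "('a::real_normed_vector \<Rightarrow> real) \<Rightarrow> 'a \<Rightarrow> 'a \<Rightarrow> real" where
  "differential f q = frechet_derivative f (at q)"

text \<open>
  Cartan's formula \<open>d\<alpha>(U, V) = U(\<alpha>(V)) - V(\<alpha>(U)) - \<alpha>([U, V])\<close> on the constant fields u, v,
  for which the bracket vanishes. For the contact form this gives \<open>dx \<and> dp\<close>, with the convention
  \<open>(a \<and> b)(u, v) = a(u) b(v) - a(v) b(u)\<close>.
\<close>
definition ext_deriv :: "('a::real_normed_vector \<Rightarrow> 'a \<Rightarrow> real) \<Rightarrow> 'a \<Rightarrow> 'a \<Rightarrow> 'a \<Rightarrow> real" where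
  "ext_deriv \<alpha> q u v = differential (\<lambda>r. \<alpha> r v) q u - differential (\<lambda>r. \<alpha> r u) q v"

text \<open>
  The two defining equations of the contact Hamiltonian vector field, the second one evaluated on
  every tangent vector v; \<^term>\<open>differential h q (0, 0, 1)\<close> is \<open>\<partial>h/\<partial>z\<close>. Differentiability of h is
  demanded because the Frechet derivative of a non-differentiable function is unspecified.
\<close>
definition contact_hamiltonian_vf :: "(pt \<Rightarrow> real) \<Rightarrow> (pt \<Rightarrow> pt) \<Rightarrow> bool" where
  "contact_hamiltonian_vf h X \<longleftrightarrow>
     (\<forall>q. h differentiable at q \<and>
          contact_form q (X q) = h q \<and>
          (\<forall>v. ext_deriv contact_form q (X q) v =
               - (differential h q v - differential h q (0, 0, 1) * contact_form q v)))"

text \<open>Solutions live on the half-line \<open>t \<ge> 0\<close>; at 0 the derivative is one-sided.\<close>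
definition integral_curve :: "('a::real_normed_vector \<Rightarrow> 'a) \<Rightarrow> (real \<Rightarrow> 'a) \<Rightarrow> bool" where
  "integral_curve X c \<longleftrightarrow>
     (\<forall>t\<ge>0. (c has_vector_derivative X (c t)) (at t within {0..}))"

definition psi :: "real \<Rightarrow> real" where
  "psi x = ln (cosh x) + ln 2"

definition spin_hamiltonian :: "real \<Rightarrow> real \<Rightarrow> real \<Rightarrow> pt \<Rightarrow> real" where
  "spin_hamiltonian \<Lambda>\<^sub>0 \<theta> \<gamma>\<^sub>0 =
     (\<lambda>(x, p, z). - \<Lambda>\<^sub>0 * (x - \<theta>) * (deriv psi x - p) + \<gamma>\<^sub>0 * (psi x - z))"

end

theory Submission
  imports Defs "HOL-Real_Asymp.Real_Asymp"
begin

text \<open>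
  In the coordinates \<open>\<Delta>\<^sub>0 = \<psi>(x) - z\<close> and \<open>\<Delta>\<^sub>1 = \<psi>'(x) - p\<close>, which measure the distance to the
  Legendre submanifold generated by \<open>\<psi>\<close>, the flow decouples into scalar linear equations. Hence
  \<open>\<Delta>\<^sub>0\<close> and \<open>\<Delta>\<^sub>1\<close> decay with rates \<open>\<gamma>\<^sub>0\<close> and \<open>\<gamma>\<^sub>0 - \<Lambda>\<^sub>0\<close>, and the limits of p and z follow
  from continuity of \<open>\<psi>\<close> and \<open>\<psi>'\<close>.
\<close>

section \<open>The potential and its derivatives\<close>

lemma has_real_derivative_psi: "(psi has_real_derivative tanh x) (at x within S)"
proof -
  have "psi = (\<lambda>x. ln (cosh x) + ln 2)"
    by (simp add: fun_eq_iff psi_def)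
  moreover have "((\<lambda>x. ln (cosh x) + ln 2) has_real_derivative tanh x) (at x within S)"
    by (auto intro!: derivative_eq_intros simp: tanh_def cosh_real_pos divide_simps)
  ultimately show ?thesis by simp
qed

lemma deriv_psi: "deriv psi = tanh"
  by (rule ext) (rule DERIV_imp_deriv[OF has_real_derivative_psi])

lemma has_real_derivative_tanh:
  "(tanh has_real_derivative 1 - (tanh x)\<^sup>2) (at (x::real) within S)"
  by (auto intro!: derivative_eq_intros)

lemma deriv_tanh: "deriv tanh (x::real) = 1 - (tanh x)\<^sup>2"
  by (rule DERIV_imp_deriv[OF has_real_derivative_tanh])

section \<open>Contact Hamiltonian vector fields in coordinates\<close>

lemma frechet_derivative_eqI:
  "(f has_derivative f') (at x) \<Longrightarrow> frechet_derivative f (at x) = f'"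
  by (metis frechet_derivative_at)

lemma contact_form_simp: "contact_form (x, p, z) (vx, vp, vz) = vz - p * vx"
  by (simp add: contact_form_def)

text \<open>For a fixed tangent vector the contact form depends on the base point only through the
  coordinate p, and linearly, so each differential is a multiple of dp; antisymmetrising leaves dx
  \<and> dp.\<close>

lemma ext_deriv_contact_form:
  "ext_deriv contact_form q (ux, up, uz) (vx, vp, vz) = ux * vp - up * vx"
proof -
  have "((\<lambda>r. contact_form r (a, b, c)) has_derivative (\<lambda>w. - fst (snd w) * a)) (at q)" for a b c
    unfolding contact_form_def case_prod_unfold
    by (auto intro!: derivative_eq_intros)
  from frechet_derivative_eqI[OF this] show ?thesis
    by (simp add: ext_deriv_def differential_def)
qed

text \<open>The form dx \<and> dp determines a vector up to its z-component, and the contact form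
  equation then fixes that component. Being an equivalence for arbitrary \<open>X\<close>, this
  yields existence and uniqueness of the field together.\<close>

lemma contact_hamiltonian_vf_iff:
  assumes h: "\<And>x p z. (h has_derivative (\<lambda>(a, b, c). hx x p z * a + hp x p z * b + hz x p z * c))
                        (at (x, p, z))"
  shows "contact_hamiltonian_vf h X \<longleftrightarrow>
           (\<forall>x p z. X (x, p, z) =
              (- hp x p z, hx x p z + p * hz x p z, h (x, p, z) - p * hp x p z))"
proof -
  have diff: "h differentiable at (x, p, z)" for x p z
    using h differentiable_def by blast
  have D: "differential h (x, p, z) (a, b, c) = hx x p z * a + hp x p z * b + hz x p z * c"
    for x p z a b c
    by (simp add: differential_def frechet_derivative_eqI[OF h])
  have "(contact_form (x, p, z) u = h (x, p, z) \<and>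
         (\<forall>v. ext_deriv contact_form (x, p, z) u v =
            - (differential h (x, p, z) v
               - differential h (x, p, z) (0, 0, 1) * contact_form (x, p, z) v)))
        \<longleftrightarrow> u = (- hp x p z, hx x p z + p * hz x p z, h (x, p, z) - p * hp x p z)"
    (is "?L \<longleftrightarrow> ?R") for x p z u
  proof -
    obtain ux up uz where u: "u = (ux, up, uz)"
      by (metis prod.exhaust)
    show ?thesis
    proof
      assume L: ?L
      then have "ext_deriv contact_form (x, p, z) u v =
              - (differential h (x, p, z) v
                 - differential h (x, p, z) (0, 0, 1) * contact_form (x, p, z) v)" for v
        by blast
      \<comment> \<open>The x-direction gives \<open>up\<close>, the p-direction gives
        \<open>ux\<close>, and the contact form equation in \<open>L\<close> then gives
        \<open>uz\<close>. The z-direction carries no information: there both sides vanish.\<close>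
      from this[of "(1, 0, 0)"] this[of "(0, 1, 0)"] L show ?R
        by (auto simp: u ext_deriv_contact_form D contact_form_simp algebra_simps)
    next
      assume ?R
      then show ?L
        by (auto simp: u ext_deriv_contact_form D contact_form_simp algebra_simps)
    qed
  qed
  then show ?thesis
    unfolding contact_hamiltonian_vf_def split_paired_All[where 'a = real]
    by (simp only: diff simp_thms)
qed

lemma has_derivative_spin_hamiltonian:
  "(spin_hamiltonian L \<theta> g has_derivative
     (\<lambda>(a, b, c). (- L * (tanh x - p) - L * (x - \<theta>) * (1 - (tanh x)\<^sup>2) + g * tanh x) * a
                  + L * (x - \<theta>) * b + (- g) * c)) (at (x, p, z))"
proof -
  have T: "((\<lambda>q. tanh (fst q)) has_derivative (\<lambda>w. (1 - (tanh x)\<^sup>2) * fst w)) (at (x, p, z))"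
    using has_derivative_compose[OF has_derivative_fst[OF has_derivative_ident]
        has_real_derivative_tanh[unfolded has_field_derivative_def]]
    by fastforce
  have P: "((\<lambda>q. psi (fst q)) has_derivative (\<lambda>w. tanh x * fst w)) (at (x, p, z))"
    using has_derivative_compose[OF has_derivative_fst[OF has_derivative_ident]
        has_real_derivative_psi[unfolded has_field_derivative_def]]
    by fastforce
  show ?thesis
    unfolding spin_hamiltonian_def case_prod_unfold deriv_psi
    by (rule derivative_eq_intros T P refl)+ (auto simp: fun_eq_iff algebra_simps)
qed

text \<open>In the p-component, the \<gamma>-terms of \<partial>h/\<partial>x and p
  \<partial>h/\<partial>z combine to a multiple of \<psi>'(x) - p. In the z-component, subtracting p
  \<partial>h/\<partial>p cancels the only terms containing p.\<close>

lemma contact_hamiltonian_vf_spin_iff: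
  "contact_hamiltonian_vf (spin_hamiltonian L \<theta> g) X \<longleftrightarrow>
    (\<forall>x p z. X (x, p, z) =
      (- L * (x - \<theta>),
       - L * (x - \<theta>) * deriv (deriv psi) x - L * (deriv psi x - p) + g * (deriv psi x - p),
       - L * (x - \<theta>) * deriv psi x + g * (psi x - z)))"
  unfolding contact_hamiltonian_vf_iff[OF has_derivative_spin_hamiltonian]
  by (simp add: spin_hamiltonian_def deriv_psi deriv_tanh algebra_simps)

section \<open>Solution curves and scalar linear equations\<close>

lemma has_vector_derivative_Pair_iff:
  "((\<lambda>t. (f t, g t)) has_vector_derivative (a, b)) (at t within S) \<longleftrightarrow>
    (f has_vector_derivative a) (at t within S) \<and> (g has_vector_derivative b) (at t within S)"
  (is "?L \<longleftrightarrow> ?R")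
proof
  assume ?L
  then show ?R
    unfolding has_vector_derivative_def
    by (auto dest: has_derivative_fst has_derivative_snd)
next
  assume ?R
  then show ?L by (auto intro: has_vector_derivative_Pair)
qed

lemma integral_curve_triple_iff:
  "integral_curve X (\<lambda>t. (x t, p t, z t)) \<longleftrightarrow>
    (\<forall>t\<ge>0. (x has_real_derivative fst (X (x t, p t, z t))) (at t within {0..}) \<and>
           (p has_real_derivative fst (snd (X (x t, p t, z t)))) (at t within {0..}) \<and>
           (z has_real_derivative snd (snd (X (x t, p t, z t)))) (at t within {0..}))"
  unfolding integral_curve_def has_real_derivative_iff_has_vector_derivative
    has_vector_derivative_Pair_iff[symmetric] prod.collapse
  by (rule refl)

text \<open>The relation between \<open>y\<close> and \<open>D\<close> is symmetric, as
  \<open>y\<close> is also F(x) - D, so the chain and difference rules serve both directions. It is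
  applied with \<open>psi\<close> for z and with \<open>tanh\<close> for p.\<close>

lemma has_real_derivative_comp_minus_iff:
  fixes F F' x y :: "real \<Rightarrow> real"
  assumes "\<And>u. (F has_real_derivative F' u) (at u)"
    and "(x has_real_derivative x') (at t within S)"
    and D: "\<And>s. D s = F (x s) - y s"
  shows "(y has_real_derivative y') (at t within S) \<longleftrightarrow>
         (D has_real_derivative F' (x t) * x' - y') (at t within S)"
proof -
  have F: "((\<lambda>s. F (x s)) has_real_derivative F' (x t) * x') (at t within S)"
    using DERIV_chain2 assms(1,2) by blast
  have D_eq: "D = (\<lambda>s. F (x s) - y s)" and y_eq: "y = (\<lambda>s. F (x s) - D s)"
    by (simp_all add: fun_eq_iff D)
  show ?thesis
  proof
    assume "(y has_real_derivative y') (at t within S)"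
    from DERIV_diff[OF F this] show "(D has_real_derivative F' (x t) * x' - y') (at t within S)"
      by (simp only: D_eq)
  next
    assume "(D has_real_derivative F' (x t) * x' - y') (at t within S)"
    from DERIV_diff[OF F this] show "(y has_real_derivative y') (at t within S)"
      by (subst y_eq) simp
  qed
qed

text \<open>Integrating factor: y(t) exp(-ct) has zero derivative on the convex set
  \<open>{0..}\<close>, one-sided at 0, hence is constant there and equals its value at 0.\<close>

lemma linear_ode_solution:
  fixes y :: "real \<Rightarrow> real"
  assumes "\<And>t. 0 \<le> t \<Longrightarrow> (y has_real_derivative c * y t) (at t within {0..})" and "0 \<le> t"
  shows "y t = y 0 * exp (c * t)"
proof -
  have "((\<lambda>t. y t * exp (- c * t)) has_real_derivative 0) (at s within {0..})"
    if "s \<in> {0..}" for s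
  proof -
    have "((\<lambda>t. exp (- c * t)) has_real_derivative exp (- c * s) * - c) (at s within {0..})"
      by (auto intro!: derivative_eq_intros)
    from DERIV_mult[OF assms(1) this] that show ?thesis
      by simp
  qed
  then have "\<exists>k. \<forall>s\<in>{0..}. y s * exp (- c * s) = k"
    by (intro has_field_derivative_zero_constant) simp_all
  then obtain k where k: "\<And>s. 0 \<le> s \<Longrightarrow> y s * exp (- c * s) = k"
    by (metis atLeast_iff)
  have "y t = (y t * exp (- c * t)) * exp (c * t)"
    by (simp add: exp_minus)
  also have "\<dots> = (y 0 * exp (- c * 0)) * exp (c * t)"
    by (simp only: k \<open>0 \<le> t\<close> order_refl)
  finally show ?thesis
    by simp
qed

text \<open>The explicit solution is known only for nonnegative times, so it is compared with
  \<open>y\<close> eventually rather than everywhere.\<close>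

lemma linear_ode_tendsto_0:
  fixes y :: "real \<Rightarrow> real"
  assumes "\<And>t. 0 \<le> t \<Longrightarrow> (y has_real_derivative c * y t) (at t within {0..})" and "c < 0"
  shows "(y \<longlongrightarrow> 0) at_top"
proof -
  have "((\<lambda>t. y 0 * exp (c * t)) \<longlongrightarrow> 0) at_top"
    using \<open>c < 0\<close> by real_asymp
  moreover have "\<forall>\<^sub>F t in at_top. y 0 * exp (c * t) = y t"
    using eventually_ge_at_top[of 0]
    by eventually_elim (rule linear_ode_solution[OF assms(1), symmetric])
  ultimately show ?thesis by (rule Lim_transform_eventually)
qed

text \<open>Substituting the x-equation into the chain rule for \<psi>'(x) and \<psi>(x) produces
  exactly the drift terms containing -L (x - \<theta>), which cancel in the differences and leave
  the linear decay terms.\<close>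

lemma relaxation_coordinates_iff:
  assumes "\<And>t. \<Delta>\<^sub>0 t = psi (x t) - z t" and "\<And>t. \<Delta>\<^sub>1 t = deriv psi (x t) - p t"
  shows
    "(x has_real_derivative - L * (x t - \<theta>)) (at t within S) \<and>
     (p has_real_derivative
        - L * (x t - \<theta>) * deriv (deriv psi) (x t)
        - L * (deriv psi (x t) - p t) + g * (deriv psi (x t) - p t)) (at t within S) \<and>
     (z has_real_derivative
        - L * (x t - \<theta>) * deriv psi (x t) + g * (psi (x t) - z t)) (at t within S)
     \<longleftrightarrow>
     (x has_real_derivative - L * (x t - \<theta>)) (at t within S) \<and>
     (\<Delta>\<^sub>1 has_real_derivative L * \<Delta>\<^sub>1 t - g * \<Delta>\<^sub>1 t) (at t within S) \<and>
     (\<Delta>\<^sub>0 has_real_derivative - g * \<Delta>\<^sub>0 t) (at t within S)"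
\<comment> \<open>The x-equation occurs on both sides; if it fails, both are false, and otherwise it
  supplies the derivative needed for the chain rule.\<close>
proof (cases "(x has_real_derivative - L * (x t - \<theta>)) (at t within S)")
  case True
  note p = has_real_derivative_comp_minus_iff[OF has_real_derivative_tanh True
      assms(2)[unfolded deriv_psi]]
  note z = has_real_derivative_comp_minus_iff[OF has_real_derivative_psi True assms(1)]
  show ?thesis
    unfolding deriv_psi deriv_tanh p z by (simp add: assms deriv_psi algebra_simps)
qed simp

theorem theorem4p9:
  fixes \<Lambda>\<^sub>0 \<theta> \<gamma>\<^sub>0 :: real
  assumes "0 < \<Lambda>\<^sub>0" and "0 < \<theta>" and "0 < \<gamma>\<^sub>0" and "\<Lambda>\<^sub>0 < \<gamma>\<^sub>0"
  shows
    "(\<forall>X. contact_hamiltonian_vf (spin_hamiltonian \<Lambda>\<^sub>0 \<theta> \<gamma>\<^sub>0) X \<longleftrightarrow>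
        (\<forall>x p z. X (x, p, z) =
          (- \<Lambda>\<^sub>0 * (x - \<theta>),
           - \<Lambda>\<^sub>0 * (x - \<theta>) * deriv (deriv psi) x - \<Lambda>\<^sub>0 * (deriv psi x - p) + \<gamma>\<^sub>0 * (deriv psi x - p),
           - \<Lambda>\<^sub>0 * (x - \<theta>) * deriv psi x + \<gamma>\<^sub>0 * (psi x - z))))
     \<and>
     (\<forall>X (x :: real \<Rightarrow> real) (p :: real \<Rightarrow> real) (z :: real \<Rightarrow> real).
        contact_hamiltonian_vf (spin_hamiltonian \<Lambda>\<^sub>0 \<theta> \<gamma>\<^sub>0) X \<longrightarrow>
        (integral_curve X (\<lambda>t. (x t, p t, z t)) \<longleftrightarrow>
          (\<forall>t\<ge>0.
            (x has_real_derivative - \<Lambda>\<^sub>0 * (x t - \<theta>)) (at t within {0..}) \<and>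
            (p has_real_derivative
               - \<Lambda>\<^sub>0 * (x t - \<theta>) * deriv (deriv psi) (x t)
               - \<Lambda>\<^sub>0 * (deriv psi (x t) - p t) + \<gamma>\<^sub>0 * (deriv psi (x t) - p t)) (at t within {0..}) \<and>
            (z has_real_derivative
               - \<Lambda>\<^sub>0 * (x t - \<theta>) * deriv psi (x t) + \<gamma>\<^sub>0 * (psi (x t) - z t)) (at t within {0..}))))
     \<and>
     (\<forall>(x :: real \<Rightarrow> real) (p :: real \<Rightarrow> real) (z :: real \<Rightarrow> real) \<Delta>\<^sub>0 \<Delta>\<^sub>1.
        (\<forall>t. \<Delta>\<^sub>0 t = psi (x t) - z t) \<and> (\<forall>t. \<Delta>\<^sub>1 t = deriv psi (x t) - p t) \<longrightarrow>
        ((\<forall>t\<ge>0.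
            (x has_real_derivative - \<Lambda>\<^sub>0 * (x t - \<theta>)) (at t within {0..}) \<and>
            (p has_real_derivative
               - \<Lambda>\<^sub>0 * (x t - \<theta>) * deriv (deriv psi) (x t)
               - \<Lambda>\<^sub>0 * (deriv psi (x t) - p t) + \<gamma>\<^sub>0 * (deriv psi (x t) - p t)) (at t within {0..}) \<and>
            (z has_real_derivative
               - \<Lambda>\<^sub>0 * (x t - \<theta>) * deriv psi (x t) + \<gamma>\<^sub>0 * (psi (x t) - z t)) (at t within {0..}))
         \<longleftrightarrow>
         (\<forall>t\<ge>0.
            (x has_real_derivative - \<Lambda>\<^sub>0 * (x t - \<theta>)) (at t within {0..}) \<and>
            (\<Delta>\<^sub>1 has_real_derivative \<Lambda>\<^sub>0 * \<Delta>\<^sub>1 t - \<gamma>\<^sub>0 * \<Delta>\<^sub>1 t) (at t within {0..}) \<and>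
            (\<Delta>\<^sub>0 has_real_derivative - \<gamma>\<^sub>0 * \<Delta>\<^sub>0 t) (at t within {0..}))))
     \<and>
     (\<forall>X (x :: real \<Rightarrow> real) (p :: real \<Rightarrow> real) (z :: real \<Rightarrow> real).
        contact_hamiltonian_vf (spin_hamiltonian \<Lambda>\<^sub>0 \<theta> \<gamma>\<^sub>0) X \<and>
        integral_curve X (\<lambda>t. (x t, p t, z t)) \<and>
        (\<forall>t\<ge>0. x t = (x 0 - \<theta>) * exp (- \<Lambda>\<^sub>0 * t) + \<theta>) \<longrightarrow>
        (\<exists>x_inf p_inf z_inf.
           (x \<longlongrightarrow> x_inf) at_top \<and> (p \<longlongrightarrow> p_inf) at_top \<and> (z \<longlongrightarrow> z_inf) at_top \<and>
           x_inf = \<theta> \<and> z_inf = psi x_inf \<and> p_inf = deriv psi x_inf))"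
proof (intro conjI allI impI, goal_cases)
  case (1 X)
  show ?case by (rule contact_hamiltonian_vf_spin_iff)
next
  case (2 X x p z)
  then show ?case
    by (simp add: contact_hamiltonian_vf_spin_iff integral_curve_triple_iff)
next
  case (3 x p z \<Delta>\<^sub>0 \<Delta>\<^sub>1)
  then show ?case
    using relaxation_coordinates_iff[where L = \<Lambda>\<^sub>0 and \<theta> = \<theta> and g = \<gamma>\<^sub>0 and S = "{0..}",
        of \<Delta>\<^sub>0 x z \<Delta>\<^sub>1 p]
    by simp
next
  case (4 X x p z)
  then have vf: "contact_hamiltonian_vf (spin_hamiltonian \<Lambda>\<^sub>0 \<theta> \<gamma>\<^sub>0) X"
    and curve: "integral_curve X (\<lambda>t. (x t, p t, z t))"
    and x_eq: "\<And>t. 0 \<le> t \<Longrightarrow> x t = (x 0 - \<theta>) * exp (- \<Lambda>\<^sub>0 * t) + \<theta>"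
    by blast+
  define \<Delta>\<^sub>0 where "\<Delta>\<^sub>0 t = psi (x t) - z t" for t
  define \<Delta>\<^sub>1 where "\<Delta>\<^sub>1 t = deriv psi (x t) - p t" for t
  have ode: "(\<Delta>\<^sub>1 has_real_derivative \<Lambda>\<^sub>0 * \<Delta>\<^sub>1 t - \<gamma>\<^sub>0 * \<Delta>\<^sub>1 t) (at t within {0..}) \<and>
      (\<Delta>\<^sub>0 has_real_derivative - \<gamma>\<^sub>0 * \<Delta>\<^sub>0 t) (at t within {0..})" if "0 \<le> t" for t
    using vf curve that
      relaxation_coordinates_iff[where L = \<Lambda>\<^sub>0 and \<theta> = \<theta> and g = \<gamma>\<^sub>0 and S = "{0..}",
        of \<Delta>\<^sub>0 x z \<Delta>\<^sub>1 p t, OF \<Delta>\<^sub>0_def \<Delta>\<^sub>1_def]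
    by (simp add: contact_hamiltonian_vf_spin_iff integral_curve_triple_iff)
  have \<Delta>\<^sub>0: "(\<Delta>\<^sub>0 \<longlongrightarrow> 0) at_top"
    by (rule linear_ode_tendsto_0[of _ "- \<gamma>\<^sub>0"]) (use ode assms in simp_all)
  \<comment> \<open>Here \<gamma> > \<Lambda> enters: it makes the coefficient of this linear
    equation negative.\<close>
  have \<Delta>\<^sub>1: "(\<Delta>\<^sub>1 \<longlongrightarrow> 0) at_top"
    by (rule linear_ode_tendsto_0[of _ "\<Lambda>\<^sub>0 - \<gamma>\<^sub>0"])
      (use ode assms in \<open>simp_all add: left_diff_distrib\<close>)
  have x: "(x \<longlongrightarrow> \<theta>) at_top"
  proof (rule Lim_transform_eventually)
    show "((\<lambda>t. (x 0 - \<theta>) * exp (- \<Lambda>\<^sub>0 * t) + \<theta>) \<longlongrightarrow> \<theta>) at_top"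
      using \<open>0 < \<Lambda>\<^sub>0\<close> by real_asymp
    show "\<forall>\<^sub>F t in at_top. (x 0 - \<theta>) * exp (- \<Lambda>\<^sub>0 * t) + \<theta> = x t"
      using eventually_ge_at_top[of 0] by eventually_elim (rule x_eq[symmetric])
  qed
  have "((\<lambda>t. psi (x t)) \<longlongrightarrow> psi \<theta>) at_top"
    by (rule isCont_tendsto_compose[OF DERIV_isCont[OF has_real_derivative_psi] x])
  \<comment> \<open>z is recovered as \<psi>(x) minus a quantity tending to 0; p is treated in the
    same way below, with \<psi>' in place of \<psi>.\<close>
  from tendsto_diff[OF this \<Delta>\<^sub>0] have z: "(z \<longlongrightarrow> psi \<theta>) at_top"
    by (simp add: \<Delta>\<^sub>0_def)
  have "((\<lambda>t. deriv psi (x t)) \<longlongrightarrow> deriv psi \<theta>) at_top"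
    unfolding deriv_psi
    by (rule isCont_tendsto_compose[OF DERIV_isCont[OF has_real_derivative_tanh] x])
  from tendsto_diff[OF this \<Delta>\<^sub>1] have p: "(p \<longlongrightarrow> deriv psi \<theta>) at_top"
    by (simp add: \<Delta>\<^sub>1_def)
  from x p z show ?case by blast
qed

end
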